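(* Let $m\ge 1$ be an integer and, for $\phi$ in the open set $D=\{\phi\in\mathbb{R}^m:\ 0<\phi_m<\cdots<\phi_1<\pi/2\}$, let $$h(\phi)=\prod_{j=1}^m\sin(\phi_j)\sin(2\phi_j)\prod_{1\le j<l\le m}\sin(\phi_j-\phi_l)\sin(\phi_j+\phi_l).$$ Then $h$ is not an eigenfunction of $\Delta/2$, and there exists a strictly negative constant $c$ such that $\Delta h>c\,h$ on $D$.
   Context: $\Delta=\sum_{i=1}^m\partial_i^2$ is the Euclidean Laplacian on $\mathbb{R}^m$. The function $h$ is $\prod_{\alpha\in R_+}\sin\langle\alpha,\phi\rangle$, where $R_+=\{e_i,\,2e_i:\ 1\le i\le m\}\cup\{e_i\pm e_j:\ 1\le i<j\le m\}$ is the positive system of the non-reduced root system of type $BC_m$; $h$ is strictly positive on $D$, which is $\pi$ times the principal Weyl alcove $\{0<x_m<\cdots<x_1<1/2\}$. *)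

theory Defs
  imports "HOL-Analysis.Analysis"
begin

text \<open>
  The space \<open>\<real>\<^sup>m\<close> is rendered as \<^typ>\<open>real ^ 'm\<close>, where the index type \<open>'m\<close> is an arbitrary
  finite linear order: it stands for the ordered index set \<open>{1 < \<dots> < m}\<close>, with \<open>m = CARD('m) \<ge> 1\<close>.
\<close>

definition partial_deriv :: "'a::euclidean_space \<Rightarrow> ('a \<Rightarrow> real) \<Rightarrow> 'a \<Rightarrow> real"
  where "partial_deriv b f x = deriv (\<lambda>t. f (x + t *\<^sub>R b)) 0"

definition laplacian :: "('a::euclidean_space \<Rightarrow> real) \<Rightarrow> 'a \<Rightarrow> real"
  where "laplacian f x = (\<Sum>b\<in>Basis. partial_deriv b (partial_deriv b f) x)"

text \<open>Pointwise on \<open>S\<close>, without boundary conditions. A real eigenvalue is no restriction, since \<open>f\<close> and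
  \<open>L f\<close> are real-valued.\<close>

definition eigenfunction_on ::
    "'a set \<Rightarrow> (('a \<Rightarrow> real) \<Rightarrow> 'a \<Rightarrow> real) \<Rightarrow> ('a \<Rightarrow> real) \<Rightarrow> bool"
  where "eigenfunction_on S L f \<longleftrightarrow>
    (\<exists>x\<in>S. f x \<noteq> 0) \<and> (\<exists>lam. \<forall>x\<in>S. L f x = lam * f x)"

definition alcove :: "(real ^ 'm::{finite,linorder}) set"
  where "alcove = {\<phi>. (\<forall>i. 0 < \<phi> $ i \<and> \<phi> $ i < pi / 2) \<and> (\<forall>i j. i < j \<longrightarrow> \<phi> $ j < \<phi> $ i)}"

definition h :: "real ^ 'm::{finite,linorder} \<Rightarrow> real"
  where "h \<phi> =
    (\<Prod>j\<in>UNIV. sin (\<phi> $ j) * sin (2 * \<phi> $ j)) *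
    (\<Prod>(j, l)\<in>{(j, l). j < l}. sin (\<phi> $ j - \<phi> $ l) * sin (\<phi> $ j + \<phi> $ l))"

end

theory Submission
  imports Defs
begin

text \<open>
  With \<open>s = sin\<^sup>2\<close>, the identity \<open>sin (a - b) sin (a + b) = s a - s b\<close> turns \<open>h\<close> into a product of
  one-variable factors \<open>sin \<phi>\<^sub>j sin 2\<phi>\<^sub>j\<close> and the Vandermonde product of the \<open>s \<phi>\<^sub>j\<close>. In \<open>\<Delta>h / h\<close> the
  interaction terms are sums over pairs and triples of distinct indices of divided differences of
  polynomials of degree one and two in \<open>s\<close>; after symmetrisation each of them is constant.
  Hence \<open>\<Delta>h / h = 2 \<Sum>\<^sub>j 1 / sin\<^sup>2 \<phi>\<^sub>j - C\<close>, which is bounded below and strictly increases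
  when \<open>\<phi>\<close> is replaced by \<open>\<phi> / 2\<close>.
\<close>

section \<open>The Laplacian as a sum of second derivatives along the axes\<close>

lemma laplacian_eq_sum_deriv_deriv:
  fixes f :: "real ^ 'm \<Rightarrow> real"
  shows "laplacian f x = (\<Sum>i\<in>UNIV. deriv (deriv (\<lambda>t. f (x + t *\<^sub>R axis i 1))) 0)"
proof -
  \<comment> \<open>\<open>DERIV_shift\<close> is an equivalence, so \<open>deriv\<close> selects
    the same value on both sides, even where that value is only a default. Nested partial
    derivatives thereby become iterated derivatives of one restriction to a line.\<close>
  have shift: "deriv (\<lambda>t. F (a + t)) 0 = deriv F a" for F :: "real \<Rightarrow> real" and a
    using DERIV_shift[of F _ 0 a] by (simp add: deriv_def add.commute)
  have "partial_deriv b (partial_deriv b f) x = deriv (deriv (\<lambda>t. f (x + t *\<^sub>R b))) 0" for b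
  proof -
    have "partial_deriv b f (x + u *\<^sub>R b) = deriv (\<lambda>t. f (x + t *\<^sub>R b)) u" for u
      using shift[of "\<lambda>t. f (x + t *\<^sub>R b)" u]
      by (simp add: partial_deriv_def scaleR_add_left add.assoc)
    then show ?thesis by (simp add: partial_deriv_def)
  qed
  then have "laplacian f x = (\<Sum>b\<in>Basis. deriv (deriv (\<lambda>t. f (x + t *\<^sub>R b))) 0)"
    by (simp add: laplacian_def)
  also have "\<dots> = (\<Sum>b\<in>range (\<lambda>i. axis i 1). deriv (deriv (\<lambda>t. f (x + t *\<^sub>R b))) 0)"
    by (rule sum.cong) (auto simp: Basis_vec_def)
  also have "\<dots> = (\<Sum>i\<in>UNIV. deriv (deriv (\<lambda>t. f (x + t *\<^sub>R axis i 1))) 0)"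
    by (subst sum.reindex) (auto simp: inj_on_def axis_eq_axis)
  finally show ?thesis .
qed

section \<open>Vandermonde form and positivity of \<open>h\<close>\<close>

lemma sin_diff_mult_sin_add: "sin (a - b) * sin (a + b) = (sin a)\<^sup>2 - (sin b)\<^sup>2" for a b :: real
proof -
  have "sin (a - b) * sin (a + b) = (sin a)\<^sup>2 * (cos b)\<^sup>2 - (cos a)\<^sup>2 * (sin b)\<^sup>2"
    by (simp add: sin_diff sin_add power2_eq_square algebra_simps)
  then show ?thesis by (simp add: cos_squared_eq algebra_simps)
qed

lemma sin_sq_strict_mono:
  fixes a b :: real
  assumes "0 < a" "a < b" "b < pi / 2"
  shows "(sin a)\<^sup>2 < (sin b)\<^sup>2"
proof -
  have "0 < sin a" using assms by (intro sin_gt_zero) auto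
  moreover have "sin a < sin b" using assms by (intro sin_monotone_2pi) auto
  ultimately show ?thesis by (simp add: power_strict_mono)
qed

lemma h_as_vandermonde:
  "h \<phi> = (\<Prod>j\<in>UNIV. sin (\<phi> $ j) * sin (2 * \<phi> $ j)) *
    (\<Prod>(j, l)\<in>{(j, l). j < l}. (sin (\<phi> $ j))\<^sup>2 - (sin (\<phi> $ l))\<^sup>2)"
  by (simp add: h_def sin_diff_mult_sin_add)

lemma h_pos:
  assumes "\<phi> \<in> alcove"
  shows "h \<phi> > 0"
  unfolding h_as_vandermonde
proof (intro mult_pos_pos prod_pos)
  fix j
  have "0 < \<phi> $ j" "\<phi> $ j < pi / 2" using assms by (auto simp: alcove_def)
  then show "0 < sin (\<phi> $ j)" "0 < sin (2 * \<phi> $ j)" by (auto intro!: sin_gt_zero)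
next
  fix p :: "'a \<times> 'a" assume "p \<in> {(j, l). j < l}"
  then show "0 < (case p of (j, l) \<Rightarrow> (sin (\<phi> $ j))\<^sup>2 - (sin (\<phi> $ l))\<^sup>2)"
    using assms by (auto simp: alcove_def intro!: sin_sq_strict_mono)
qed

section \<open>Dependence of \<open>h\<close> on a single coordinate\<close>

lemma prod_less_pairs_split:
  fixes g :: "'m::{finite,linorder} \<Rightarrow> 'm \<Rightarrow> 'b::comm_monoid_mult"
  shows "(\<Prod>(j, l)\<in>{(j, l). j < l}. g j l) =
    (\<Prod>l\<in>{l. i < l}. g i l) * (\<Prod>l\<in>{l. l < i}. g l i) *
    (\<Prod>(j, l)\<in>{(j, l). j < l \<and> j \<noteq> i \<and> l \<noteq> i}. g j l)"
proof -
  let ?A = "Pair i ` {l. i < l}" and ?B = "(\<lambda>l. (l, i)) ` {l. l < i}"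
  let ?C = "{(j, l). j < l \<and> j \<noteq> i \<and> l \<noteq> i}"
  have "{(j, l). j < l} = (?A \<union> ?B) \<union> ?C" by auto
  moreover have "(?A \<union> ?B) \<inter> ?C = {}" "?A \<inter> ?B = {}" by auto
  ultimately have "(\<Prod>(j, l)\<in>{(j, l). j < l}. g j l) =
      (\<Prod>(j, l)\<in>?A. g j l) * (\<Prod>(j, l)\<in>?B. g j l) * (\<Prod>(j, l)\<in>?C. g j l)"
    by (simp add: prod.union_disjoint)
  also have "(\<Prod>(j, l)\<in>?A. g j l) = (\<Prod>l\<in>{l. i < l}. g i l)"
    by (subst prod.reindex) (auto simp: inj_on_def)
  also have "(\<Prod>(j, l)\<in>?B. g j l) = (\<Prod>l\<in>{l. l < i}. g l i)"
    by (subst prod.reindex) (auto simp: inj_on_def)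
  finally show ?thesis .
qed

text \<open>Moving coordinate \<open>i\<close> changes one weight factor and the Vandermonde factors
  of the pairs containing \<open>i\<close>; everything else goes into \<open>K\<close>. The
  remaining product runs over all other indices alike, so the order on indices survives only in the
  sign of \<open>K\<close>.\<close>

lemma h_along_axis:
  fixes \<phi> :: "real ^ 'm::{finite,linorder}"
  obtains K where "\<And>t. h (\<phi> + t *\<^sub>R axis i 1) =
    K * ((sin (\<phi> $ i + t) * sin (2 * (\<phi> $ i + t))) *
      (\<Prod>l\<in>-{i}. (sin (\<phi> $ i + t))\<^sup>2 - (sin (\<phi> $ l))\<^sup>2))"
proof
  fix t :: real
  define \<psi> where "\<psi> = \<phi> + t *\<^sub>R axis i 1"
  have \<psi>i: "\<psi> $ i = \<phi> $ i + t" by (simp add: \<psi>_def)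
  have \<psi>l: "\<psi> $ l = \<phi> $ l" if "l \<noteq> i" for l using that by (simp add: \<psi>_def axis_def)
  define w where "w = (\<lambda>a. sin a * sin (2 * a) :: real)"
  define s where "s = (\<lambda>a. (sin a)\<^sup>2 :: real)"
  define W where "W = (\<Prod>l\<in>-{i}. w (\<phi> $ l))"
  define V where "V = (\<Prod>(j, l)\<in>{(j, l). j < l \<and> j \<noteq> i \<and> l \<noteq> i}. s (\<phi> $ j) - s (\<phi> $ l))"
  \<comment> \<open>The sign from reversing each factor with \<open>l < i\<close>, so that
    coordinate \<open>i\<close> always comes first in the difference.\<close>
  define \<sigma> where "\<sigma> = ((-1) ^ card {l. l < i} :: real)"
  have UN: "(UNIV::'m set) = insert i (-{i})" by auto
  have 1: "(\<Prod>j\<in>UNIV. w (\<psi> $ j)) = w (\<phi> $ i + t) * W"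
    unfolding W_def by (subst UN, subst prod.insert) (auto simp: \<psi>i \<psi>l)
  have 2: "(\<Prod>l\<in>{l. i < l}. s (\<psi> $ i) - s (\<psi> $ l)) = (\<Prod>l\<in>{l. i < l}. s (\<phi> $ i + t) - s (\<phi> $ l))"
    by (auto simp: \<psi>i \<psi>l intro!: prod.cong)
  have "(\<Prod>l\<in>{l. l < i}. s (\<psi> $ l) - s (\<psi> $ i)) = (\<Prod>l\<in>{l. l < i}. (-1) * (s (\<phi> $ i + t) - s (\<phi> $ l)))"
    by (auto simp: \<psi>i \<psi>l intro!: prod.cong)
  then have 3: "(\<Prod>l\<in>{l. l < i}. s (\<psi> $ l) - s (\<psi> $ i)) = \<sigma> * (\<Prod>l\<in>{l. l < i}. s (\<phi> $ i + t) - s (\<phi> $ l))"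
    by (simp only: prod.distrib prod_constant \<sigma>_def)
  have 4: "(\<Prod>(j, l)\<in>{(j, l). j < l \<and> j \<noteq> i \<and> l \<noteq> i}. s (\<psi> $ j) - s (\<psi> $ l)) = V"
    unfolding V_def by (auto simp: \<psi>l intro!: prod.cong)
  have compl: "-{i} = {l. i < l} \<union> {l. l < i}" by auto
  have 5: "(\<Prod>l\<in>-{i}. s (\<phi> $ i + t) - s (\<phi> $ l)) =
      (\<Prod>l\<in>{l. i < l}. s (\<phi> $ i + t) - s (\<phi> $ l)) * (\<Prod>l\<in>{l. l < i}. s (\<phi> $ i + t) - s (\<phi> $ l))"
    unfolding compl by (rule prod.union_disjoint) auto
  have "h \<psi> = (\<Prod>j\<in>UNIV. w (\<psi> $ j)) * (\<Prod>(j, l)\<in>{(j, l). j < l}. s (\<psi> $ j) - s (\<psi> $ l))"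
    by (simp add: h_as_vandermonde w_def s_def)
  also have "\<dots> = (W * \<sigma> * V) * (w (\<phi> $ i + t) * (\<Prod>l\<in>-{i}. s (\<phi> $ i + t) - s (\<phi> $ l)))"
    unfolding 1 prod_less_pairs_split[of _ i] 2 3 4 5 by (simp add: mult_ac)
  \<comment> \<open>The witness \<open>K\<close> is written out in full: it may not depend on
    \<open>t\<close>, and the abbreviations were introduced after \<open>t\<close> was
    fixed.\<close>
  finally show "h (\<phi> + t *\<^sub>R axis i 1) =
    ((\<Prod>l\<in>-{i}. sin (\<phi> $ l) * sin (2 * \<phi> $ l)) * (-1) ^ card {l. l < i} *
      (\<Prod>(j, l)\<in>{(j, l). j < l \<and> j \<noteq> i \<and> l \<noteq> i}. (sin (\<phi> $ j))\<^sup>2 - (sin (\<phi> $ l))\<^sup>2)) *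
    ((sin (\<phi> $ i + t) * sin (2 * (\<phi> $ i + t))) *
      (\<Prod>l\<in>-{i}. (sin (\<phi> $ i + t))\<^sup>2 - (sin (\<phi> $ l))\<^sup>2))"
    by (simp add: W_def \<sigma>_def V_def w_def s_def \<psi>_def)
qed

section \<open>Second derivative of a weight times a product, applied to \<open>h\<close>\<close>

lemma deriv_deriv_eqI:
  fixes f :: "real \<Rightarrow> real"
  assumes "\<And>t. (f has_real_derivative f' t) (at t)" and "(f' has_real_derivative f'') (at a)"
  shows "deriv (deriv f) a = f''"
proof -
  have "deriv f = f'" using assms(1) by (auto intro: DERIV_imp_deriv)
  then show ?thesis using assms(2) by (simp add: DERIV_imp_deriv)
qed

text \<open>Leibniz rule, sorted by how many factors of the product are differentiated: none, one,
  or two distinct ones. Summing over ordered pairs \<open>(l, k)\<close> accounts for the factor 2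
  in the last case.\<close>

lemma deriv_deriv_mult_prod:
  fixes w w' w'' s s' s'' :: "real \<Rightarrow> real" and c :: "'i \<Rightarrow> real"
  assumes w: "\<And>t. (w has_real_derivative w' t) (at t)" "\<And>t. (w' has_real_derivative w'' t) (at t)"
    and s: "\<And>t. (s has_real_derivative s' t) (at t)" "\<And>t. (s' has_real_derivative s'' t) (at t)"
    and L: "finite L" and nz: "\<And>l. l \<in> L \<Longrightarrow> s a \<noteq> c l"
  shows "deriv (deriv (\<lambda>t. K * (w t * (\<Prod>l\<in>L. s t - c l)))) a =
    K * (\<Prod>l\<in>L. s a - c l) *
      (w'' a + (\<Sum>l\<in>L. (2 * w' a * s' a + w a * s'' a) / (s a - c l)) +
       (\<Sum>l\<in>L. \<Sum>k\<in>L - {l}. w a * (s' a)\<^sup>2 / ((s a - c l) * (s a - c k))))"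
proof -
  \<comment> \<open>Both depend on the set of factors, since differentiating \<open>D L\<close>
    produces \<open>D (L - {l})\<close>. Factors are omitted rather than divided out because the
    first derivative is needed at every \<open>t\<close>, while \<open>s t - c l\<close> is known to
    be nonzero only at \<open>a\<close>.\<close>
  define P where "P = (\<lambda>A t. \<Prod>l\<in>A. s t - c l)"
  define D where "D = (\<lambda>A t. \<Sum>l\<in>A. s' t * P (A - {l}) t)"
  have P: "(P A has_real_derivative D A t) (at t)" for A t
    unfolding P_def D_def
    by (rule has_field_derivative_prod) (auto intro!: derivative_eq_intros s)
  have D: "(D A has_real_derivative
      (\<Sum>l\<in>A. s'' t * P (A - {l}) t + D (A - {l}) t * s' t)) (at t)" for A t
  proof -
    have "D A = (\<lambda>t. \<Sum>l\<in>A. s' t * P (A - {l}) t)" by (simp add: D_def)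
    then show ?thesis by (simp only:) (intro DERIV_sum DERIV_mult s P)
  qed
  have D0: "D A a = P A a * (\<Sum>l\<in>A. s' a / (s a - c l))" if "A \<subseteq> L" for A
    using that L nz finite_subset[OF that L]
    by (auto simp: D_def P_def sum_distrib_left prod_diff1 field_simps intro!: sum.cong)
  have P1: "P (L - {l}) a = P L a / (s a - c l)" if "l \<in> L" for l
    using that L nz by (simp add: P_def prod_diff1)
  have 1: "D L a = P L a * (\<Sum>l\<in>L. s' a / (s a - c l))" by (rule D0) simp
  have 2: "(\<Sum>l\<in>L. s'' a * P (L - {l}) a) = P L a * (\<Sum>l\<in>L. s'' a / (s a - c l))"
    unfolding sum_distrib_left by (rule sum.cong) (auto simp: P1)
  have 3: "(\<Sum>l\<in>L. D (L - {l}) a) =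
      P L a * (\<Sum>l\<in>L. \<Sum>k\<in>L - {l}. s' a / ((s a - c l) * (s a - c k)))"
    unfolding sum_distrib_left
  proof (rule sum.cong)
    fix l assume "l \<in> L"
    then show "D (L - {l}) a = (\<Sum>k\<in>L - {l}. P L a * (s' a / ((s a - c l) * (s a - c k))))"
      by (subst D0) (auto simp: P1 sum_distrib_left)
  qed simp
  have "deriv (deriv (\<lambda>t. K * (w t * P L t))) a =
      K * ((w'' a * P L a + D L a * w' a) +
        (w' a * D L a + (\<Sum>l\<in>L. s'' a * P (L - {l}) a + D (L - {l}) a * s' a) * w a))"
    by (rule deriv_deriv_eqI[where f' = "\<lambda>t. K * (w' t * P L t + D L t * w t)"])
      (auto intro!: derivative_eq_intros w P D)
  also have "\<dots> = K * (w'' a * P L a + 2 * w' a * D L a + w a * (\<Sum>l\<in>L. s'' a * P (L - {l}) a) +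
        w a * s' a * (\<Sum>l\<in>L. D (L - {l}) a))"
    by (simp add: sum.distrib sum_distrib_left sum_distrib_right algebra_simps)
  also have "\<dots> = K * P L a *
      (w'' a + (2 * w' a * (\<Sum>l\<in>L. s' a / (s a - c l)) + w a * (\<Sum>l\<in>L. s'' a / (s a - c l))) +
       w a * s' a * (\<Sum>l\<in>L. \<Sum>k\<in>L - {l}. s' a / ((s a - c l) * (s a - c k))))"
    unfolding 1 2 3 by (simp only: distrib_left mult_ac)
  also have "2 * w' a * (\<Sum>l\<in>L. s' a / (s a - c l)) + w a * (\<Sum>l\<in>L. s'' a / (s a - c l)) =
      (\<Sum>l\<in>L. (2 * w' a * s' a + w a * s'' a) / (s a - c l))"
    by (simp add: sum_distrib_left sum.distrib add_divide_distrib)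
  also have "w a * s' a * (\<Sum>l\<in>L. \<Sum>k\<in>L - {l}. s' a / ((s a - c l) * (s a - c k))) =
      (\<Sum>l\<in>L. \<Sum>k\<in>L - {l}. w a * (s' a)\<^sup>2 / ((s a - c l) * (s a - c k)))"
    by (simp add: sum_distrib_left power2_eq_square mult.assoc)
  finally show ?thesis unfolding P_def .
qed

text \<open>For the weight \<open>sin x * sin (2 * x)\<close> and \<open>s = sin\<^sup>2 x\<close>,
  every coefficient in the Leibniz expansion is the weight times a rational function of
  \<open>s\<close>. Factoring out the weight leaves an expression in the \<open>s i\<close>
  alone.\<close>

lemma deriv_deriv_h_along_axis:
  fixes \<phi> :: "real ^ 'm::{finite,linorder}"
  defines "s \<equiv> \<lambda>i. (sin (\<phi> $ i))\<^sup>2"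
  assumes "\<phi> \<in> alcove"
  shows "deriv (deriv (\<lambda>t. h (\<phi> + t *\<^sub>R axis i 1))) 0 = h \<phi> *
    (2 / s i - 9 + (\<Sum>l\<in>-{i}. (10 - 16 * s i) / (s i - s l)) +
     (\<Sum>l\<in>-{i}. \<Sum>k\<in>-{i} - {l}. 4 * s i * (1 - s i) / ((s i - s l) * (s i - s k))))"
proof -
  obtain K where K: "\<And>t. h (\<phi> + t *\<^sub>R axis i 1) =
    K * ((sin (\<phi> $ i + t) * sin (2 * (\<phi> $ i + t))) *
      (\<Prod>l\<in>-{i}. (sin (\<phi> $ i + t))\<^sup>2 - (sin (\<phi> $ l))\<^sup>2))"
    using h_along_axis[of \<phi> i] by blast
  define x where "x = \<phi> $ i"
  have x: "0 < x" "x < pi / 2" using assms(2) by (auto simp: alcove_def x_def)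
  have sx: "sin x \<noteq> 0" using x sin_gt_zero[of x] by auto
  have si: "s i = (sin x)\<^sup>2" by (simp add: s_def x_def)
  \<comment> \<open>Coordinates decrease as the index grows, so the two cases apply monotonicity of
    the squared sine in opposite directions.\<close>
  have nz: "(sin x)\<^sup>2 \<noteq> s l" if "l \<in> -{i}" for l
  proof (cases "l < i")
    case True
    then show ?thesis using assms(2) sin_sq_strict_mono[of x "\<phi> $ l"]
      by (auto simp: alcove_def s_def x_def)
  next
    case False
    with that have "i < l" by auto
    then show ?thesis using assms(2) sin_sq_strict_mono[of "\<phi> $ l" x]
      by (auto simp: alcove_def s_def x_def)
  qed
  define w where "w = (\<lambda>t. sin (x + t) * sin (2 * (x + t)))"
  define w' where "w' = (\<lambda>t. cos (x + t) * sin (2 * (x + t)) + 2 * sin (x + t) * cos (2 * (x + t)))"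
  define w'' where "w'' = (\<lambda>t. 4 * cos (x + t) * cos (2 * (x + t)) - 5 * sin (x + t) * sin (2 * (x + t)))"
  define S where "S = (\<lambda>t. (sin (x + t))\<^sup>2)"
  define S' where "S' = (\<lambda>t. 2 * sin (x + t) * cos (x + t))"
  define S'' where "S'' = (\<lambda>t. 2 * (cos (x + t))\<^sup>2 - 2 * (sin (x + t))\<^sup>2)"
  have w1: "(w has_real_derivative w' t) (at t)" for t
    unfolding w_def w'_def by (auto intro!: derivative_eq_intros)
  have w2: "(w' has_real_derivative w'' t) (at t)" for t
    unfolding w'_def w''_def by (auto intro!: derivative_eq_intros simp: algebra_simps)
  have s1: "(S has_real_derivative S' t) (at t)" for t
    unfolding S_def S'_def by (auto intro!: derivative_eq_intros)
  have s2: "(S' has_real_derivative S'' t) (at t)" for t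
    unfolding S'_def S''_def by (auto intro!: derivative_eq_intros simp: power2_eq_square algebra_simps)
  have c2: "(cos x)\<^sup>2 = 1 - (sin x)\<^sup>2" by (rule cos_squared_eq)
  have w0: "w 0 = 2 * (sin x)\<^sup>2 * cos x" by (simp add: w_def sin_double power2_eq_square)
  \<comment> \<open>With \<open>w 0 = 2 * s i * cos x\<close> and
    \<open>w'' 0 = cos x * (4 - 18 * s i)\<close>, the quotient is
    \<open>2 / s i - 9\<close>.\<close>
  have w''0: "w'' 0 = w 0 * (2 / s i - 9)"
  proof -
    have "w'' 0 = 4 * cos x * (1 - 2 * (sin x)\<^sup>2) - 10 * (sin x)\<^sup>2 * cos x"
      by (simp add: w''_def sin_double cos_double_sin power2_eq_square)
    also have "\<dots> = w 0 * (2 / s i - 9)"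
      unfolding w0 si using sx by (simp add: field_simps)
    finally show ?thesis .
  qed
  \<comment> \<open>Relative to \<open>w 0\<close>, the first term contributes
    \<open>8 - 12 * s i\<close> and the second \<open>2 - 4 * s i\<close>.\<close>
  have c0: "2 * w' 0 * S' 0 + w 0 * S'' 0 = w 0 * (10 - 16 * s i)"
  proof -
    have w'0: "w' 0 = 2 * sin x * (cos x)\<^sup>2 + 2 * sin x * (1 - 2 * (sin x)\<^sup>2)"
      by (simp add: w'_def sin_double cos_double_sin power2_eq_square)
    have S'0: "S' 0 = 2 * sin x * cos x" and S''0: "S'' 0 = 2 * (cos x)\<^sup>2 - 2 * (sin x)\<^sup>2"
      by (simp_all add: S'_def S''_def)
    show ?thesis unfolding w'0 S'0 S''0 w0 si c2
      by (simp add: power2_eq_square algebra_simps)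
  qed
  have d0: "(S' 0)\<^sup>2 = 4 * s i * (1 - s i)"
    by (simp add: S'_def si power_mult_distrib c2)
  have "deriv (deriv (\<lambda>t. h (\<phi> + t *\<^sub>R axis i 1))) 0 =
      deriv (deriv (\<lambda>t. K * (w t * (\<Prod>l\<in>-{i}. S t - s l)))) 0"
    unfolding K by (simp add: w_def S_def x_def s_def)
  also have "\<dots> = K * (\<Prod>l\<in>-{i}. S 0 - s l) *
      (w'' 0 + (\<Sum>l\<in>-{i}. (2 * w' 0 * S' 0 + w 0 * S'' 0) / (S 0 - s l)) +
       (\<Sum>l\<in>-{i}. \<Sum>k\<in>-{i} - {l}. w 0 * (S' 0)\<^sup>2 / ((S 0 - s l) * (S 0 - s k))))"
    by (rule deriv_deriv_mult_prod[OF w1 w2 s1 s2]) (auto simp: S_def nz)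
  also have "\<dots> = K * (w 0 * (\<Prod>l\<in>-{i}. S 0 - s l)) *
     (2 / s i - 9 + (\<Sum>l\<in>-{i}. (10 - 16 * s i) / (S 0 - s l)) +
     (\<Sum>l\<in>-{i}. \<Sum>k\<in>-{i} - {l}. 4 * s i * (1 - s i) / ((S 0 - s l) * (S 0 - s k))))"
    unfolding c0 d0 w''0 by (simp add: distrib_left sum_distrib_left mult_ac)
  \<comment> \<open>Evaluating the factorisation at \<open>t = 0\<close> eliminates
    \<open>K\<close>.\<close>
  also have "K * (w 0 * (\<Prod>l\<in>-{i}. S 0 - s l)) = h \<phi>"
    using K[of 0] by (simp add: w_def S_def x_def s_def)
  also have "S 0 = s i" by (simp add: S_def si)
  finally show ?thesis .
qed

section \<open>Interaction sums over pairs and triples\<close>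

text \<open>Adding the summand with \<open>i\<close> and \<open>l\<close> exchanged gives the first
  divided difference of \<open>\<alpha> + \<beta> * s\<close>, which is the slope
  \<open>\<beta>\<close>. The division by 2 undoes this doubling.\<close>

lemma sum_pairs_divided_difference:
  fixes s :: "'m::finite \<Rightarrow> real"
  assumes "inj s"
  shows "(\<Sum>i\<in>UNIV. \<Sum>l\<in>-{i}. (\<alpha> + \<beta> * s i) / (s i - s l)) =
    \<beta> * real (card {(i, l). i \<noteq> (l::'m)}) / 2"
proof -
  let ?T = "{(i, l). i \<noteq> (l::'m)}"
  define F where "F = (\<lambda>(i, l). (\<alpha> + \<beta> * s i) / (s i - s l))"
  have T: "(SIGMA i:UNIV. -{i}) = ?T" by auto
  have eq: "(\<Sum>i\<in>UNIV. \<Sum>l\<in>-{i}. (\<alpha> + \<beta> * s i) / (s i - s l)) = sum F ?T"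
    unfolding F_def T[symmetric] by (subst sum.Sigma) auto
  have "sum F ?T = (\<Sum>(i, l)\<in>?T. F (l, i))"
    by (rule sum.reindex_bij_witness[of _ "\<lambda>(i, l). (l, i)" "\<lambda>(i, l). (l, i)"]) auto
  then have "2 * sum F ?T = (\<Sum>(i, l)\<in>?T. F (i, l) + F (l, i))"
    by (simp add: sum.distrib split_def)
  also have "\<dots> = (\<Sum>(i, l)\<in>?T. \<beta>)"
  proof (rule sum.cong[OF refl], clarify)
    fix i l :: 'm assume "i \<noteq> l"
    then have "s i - s l \<noteq> 0" "s l - s i \<noteq> 0" using assms by (auto dest: injD)
    then show "F (i, l) + F (l, i) = \<beta>" unfolding F_def
      by (simp add: divide_simps) (simp add: algebra_simps)
  qed
  finally show ?thesis unfolding eq by (simp add: split_def mult.commute)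
qed

text \<open>The summand is symmetric in \<open>l\<close> and \<open>k\<close>, so the three cyclic
  rotations suffice for symmetrisation. They add up to the second divided difference of
  \<open>4 * s * (1 - s)\<close>, which is its leading coefficient -4.\<close>

lemma sum_triples_divided_difference:
  fixes s :: "'m::finite \<Rightarrow> real"
  assumes "inj s"
  shows "(\<Sum>i\<in>UNIV. \<Sum>l\<in>-{i}. \<Sum>k\<in>-{i} - {l}. 4 * s i * (1 - s i) / ((s i - s l) * (s i - s k))) =
    - 4 * real (card {(i, l, k). i \<noteq> l \<and> i \<noteq> k \<and> l \<noteq> (k::'m)}) / 3"
proof -
  let ?T = "{(i, l, k). i \<noteq> l \<and> i \<noteq> k \<and> l \<noteq> (k::'m)}"
  define F where "F = (\<lambda>(i, l, k). 4 * s i * (1 - s i) / ((s i - s l) * (s i - s k)))"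
  have T: "(SIGMA i:UNIV. SIGMA l:-{i}. -{i} - {l}) = ?T" by auto
  have eq: "(\<Sum>i\<in>UNIV. \<Sum>l\<in>-{i}. \<Sum>k\<in>-{i} - {l}. 4 * s i * (1 - s i) / ((s i - s l) * (s i - s k)))
      = sum F ?T"
    unfolding F_def T[symmetric] by (simp add: sum.Sigma split_def)
  have "sum F ?T = (\<Sum>(i, l, k)\<in>?T. F (l, k, i))"
    by (rule sum.reindex_bij_witness[of _ "\<lambda>(i, l, k). (l, k, i)" "\<lambda>(i, l, k). (k, i, l)"]) auto
  moreover have "sum F ?T = (\<Sum>(i, l, k)\<in>?T. F (k, i, l))"
    by (rule sum.reindex_bij_witness[of _ "\<lambda>(i, l, k). (k, i, l)" "\<lambda>(i, l, k). (l, k, i)"]) auto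
  ultimately have "3 * sum F ?T = (\<Sum>(i, l, k)\<in>?T. F (i, l, k) + F (l, k, i) + F (k, i, l))"
    by (simp add: sum.distrib split_def)
  also have "\<dots> = (\<Sum>(i, l, k)\<in>?T. - 4)"
  proof (rule sum.cong[OF refl], clarify)
    fix i l k :: 'm assume "i \<noteq> l" "i \<noteq> k" "l \<noteq> k"
    then have "s i - s l \<noteq> 0" "s i - s k \<noteq> 0" "s l - s k \<noteq> 0"
      "s l - s i \<noteq> 0" "s k - s i \<noteq> 0" "s k - s l \<noteq> 0" using assms by (auto dest: injD)
    moreover have "4 * a * (1 - a) / ((a - b) * (a - c)) + 4 * b * (1 - b) / ((b - c) * (b - a))
        + 4 * c * (1 - c) / ((c - a) * (c - b)) = - 4"
      if "a - b \<noteq> 0" "a - c \<noteq> 0" "b - c \<noteq> 0" "b - a \<noteq> 0" "c - a \<noteq> 0" "c - b \<noteq> 0"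
      for a b c :: real
      using that by (simp add: divide_simps) (simp add: algebra_simps)
    ultimately show "F (i, l, k) + F (l, k, i) + F (k, i, l) = - 4"
      unfolding F_def by simp
  qed
  finally show ?thesis unfolding eq by (simp add: split_def mult.commute)
qed

section \<open>Closed formula for the Laplacian of \<open>h\<close>\<close>

lemma laplacian_h:
  obtains C where "C \<ge> 0" and "\<And>\<phi> :: real ^ 'm::{finite,linorder}. \<phi> \<in> alcove \<Longrightarrow>
    laplacian h \<phi> = h \<phi> * ((\<Sum>i\<in>UNIV. 2 / (sin (\<phi> $ i))\<^sup>2) - C)"
proof
  \<comment> \<open>Each coordinate contributes 9, each ordered pair 16 / 2 and each ordered triple
    4 / 3; the total depends only on the dimension.\<close>
  let ?C = "9 * real CARD('m) + 8 * real (card {(i, l). i \<noteq> (l::'m)})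
    + 4 * real (card {(i, l, k). i \<noteq> l \<and> i \<noteq> k \<and> l \<noteq> (k::'m)}) / 3"
  show "?C \<ge> 0" by simp
  fix \<phi> :: "(real, 'm) vec" assume \<phi>: "\<phi> \<in> alcove"
  define s where "s = (\<lambda>i. (sin (\<phi> $ i))\<^sup>2)"
  have lt: "s l < s i" if "i < l" for i l
    using \<phi> that by (auto simp: s_def alcove_def intro: sin_sq_strict_mono)
  have inj: "inj s"
  proof (rule injI)
    fix i l assume "s i = s l"
    then show "i = l" using lt[of i l] lt[of l i] by (cases i l rule: linorder_cases) auto
  qed
  \<comment> \<open>The coefficient \<open>10 - 16 * s i\<close> is put in the form
    \<open>\<alpha> + \<beta> * s i\<close> to match the pair sum.\<close>
  have "laplacian h \<phi> = (\<Sum>i\<in>UNIV. h \<phi> *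
    (2 / s i - 9 + (\<Sum>l\<in>-{i}. (10 + (- 16) * s i) / (s i - s l)) +
     (\<Sum>l\<in>-{i}. \<Sum>k\<in>-{i} - {l}. 4 * s i * (1 - s i) / ((s i - s l) * (s i - s k)))))"
    unfolding laplacian_eq_sum_deriv_deriv s_def
    by (rule sum.cong) (simp_all add: deriv_deriv_h_along_axis[OF \<phi>])
  also have "\<dots> = h \<phi> * ((\<Sum>i\<in>UNIV. 2 / s i) - ?C)"
    unfolding sum_distrib_left[symmetric] sum.distrib sum_subtractf
      sum_pairs_divided_difference[OF inj] sum_triples_divided_difference[OF inj]
    by simp
  finally show "laplacian h \<phi> = h \<phi> * ((\<Sum>i\<in>UNIV. 2 / (sin (\<phi> $ i))\<^sup>2) - ?C)"
    by (simp add: s_def)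
qed

section \<open>A point of the alcove and the conclusion\<close>

lemma alcove_nonempty: "(alcove :: (real ^ 'm::{finite,linorder}) set) \<noteq> {}"
proof -
  \<comment> \<open>Counting the larger indices reverses the order and gives values from 0 to m - 1.
    The coordinates are then the m equally spaced interior points of the interval from 0 to
    \<open>pi / 2\<close>, in decreasing order.\<close>
  define n where "n = (\<lambda>i::'m. card {l. i < l})"
  define \<phi> :: "(real, 'm) vec" where "\<phi> = (\<chi> i. (real (n i) + 1) * (pi / 2 / (real CARD('m) + 1)))"
  have n: "n i < CARD('m)" for i unfolding n_def by (rule psubset_card_mono) auto
  have n_less: "n j < n i" if "i < j" for i j
    unfolding n_def using that by (intro psubset_card_mono) auto
  have "0 < \<phi> $ i" for i
    unfolding \<phi>_def by (simp add: divide_pos_pos add_pos_nonneg)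
  moreover have "\<phi> $ i < pi / 2" for i
  proof -
    have "real (n i) + 1 < real CARD('m) + 1" using n[of i] by simp
    then show ?thesis unfolding \<phi>_def by (simp add: divide_less_eq)
  qed
  moreover have "\<phi> $ j < \<phi> $ i" if "i < j" for i j
    unfolding \<phi>_def using n_less[OF that]
    by (simp add: divide_strict_right_mono)
  ultimately have "\<phi> \<in> alcove" by (simp add: alcove_def)
  then show ?thesis by blast
qed

theorem mainTheorem4:
  shows "\<not> eigenfunction_on (alcove :: (real ^ 'm::{finite,linorder}) set)
             (\<lambda>f \<phi>. laplacian f \<phi> / 2) h
       \<and> (\<exists>c<0. \<forall>\<phi>\<in>(alcove :: (real ^ 'm::{finite,linorder}) set). laplacian h \<phi> > c * h \<phi>)"
proof -
  define q :: "(real, 'm) vec \<Rightarrow> real" where "q = (\<lambda>\<phi>. \<Sum>i\<in>UNIV. 2 / (sin (\<phi> $ i))\<^sup>2)"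
  obtain C where "C \<ge> 0" and lap: "\<And>\<phi> :: (real, 'm) vec. \<phi> \<in> alcove \<Longrightarrow> laplacian h \<phi> = h \<phi> * (q \<phi> - C)"
    unfolding q_def using laplacian_h[where 'm = 'm] by metis
  have "\<not> eigenfunction_on (alcove :: (real, 'm) vec set) (\<lambda>f \<phi>. laplacian f \<phi> / 2) h"
  proof
    assume "eigenfunction_on (alcove :: (real, 'm) vec set) (\<lambda>f \<phi>. laplacian f \<phi> / 2) h"
    then obtain lam where lam: "\<And>\<phi> :: (real, 'm) vec. \<phi> \<in> alcove \<Longrightarrow> laplacian h \<phi> / 2 = lam * h \<phi>"
      unfolding eigenfunction_on_def by blast
    \<comment> \<open>Since \<open>h\<close> is positive on the alcove, an eigenvalue equation can
      be divided by \<open>h\<close> and forces \<open>q\<close> to be constant there.\<close>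
    have const: "q \<phi> = 2 * lam + C" if "\<phi> \<in> alcove" for \<phi>
    proof -
      have "h \<phi> * q \<phi> = h \<phi> * (2 * lam + C)"
        using lam[OF that] lap[OF that] by (simp add: algebra_simps)
      then show ?thesis using h_pos[OF that] by simp
    qed
    obtain \<phi> :: "(real, 'm) vec" where \<phi>: "\<phi> \<in> alcove" using alcove_nonempty by blast
    have range: "0 < \<phi> $ i" "\<phi> $ i < pi / 2" for i using \<phi> by (auto simp: alcove_def)
    \<comment> \<open>Halving keeps all the strict inequalities of the alcove and lowers every
      squared sine, so \<open>q\<close> takes a different value at \<open>\<psi>\<close>.\<close>
    define \<psi> where "\<psi> = (1 / 2) *\<^sub>R \<phi>"
    have "\<psi> $ i < pi / 2" for i using range[of i] by (simp add: \<psi>_def)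
    then have \<psi>: "\<psi> \<in> alcove" using \<phi> by (simp add: alcove_def \<psi>_def)
    have "2 / (sin (\<phi> $ i))\<^sup>2 < 2 / (sin (\<psi> $ i))\<^sup>2" for i
    proof (rule divide_strict_left_mono)
      show "(sin (\<psi> $ i))\<^sup>2 < (sin (\<phi> $ i))\<^sup>2"
        using range[of i] by (intro sin_sq_strict_mono) (auto simp: \<psi>_def)
      have "0 < sin (\<psi> $ i)" "0 < sin (\<phi> $ i)"
        using range[of i] by (auto intro!: sin_gt_zero simp: \<psi>_def)
      then show "0 < (sin (\<phi> $ i))\<^sup>2 * (sin (\<psi> $ i))\<^sup>2" by simp
    qed simp
    \<comment> \<open>Strictness of the sum rests on the index type being nonempty, that is, on m
      being at least 1.\<close>
    then have "q \<phi> < q \<psi>" unfolding q_def by (intro sum_strict_mono) auto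
    with const[OF \<phi>] const[OF \<psi>] show False by simp
  qed
  \<comment> \<open>As \<open>q\<close> is nonnegative, the ratio of \<open>laplacian h\<close> to
    \<open>h\<close> is at least \<open>- C\<close>. Subtracting 1 makes the bound strict and the
    constant negative even if \<open>C\<close> were 0.\<close>
  moreover have "- C - 1 < 0" using \<open>C \<ge> 0\<close> by simp
  moreover have "laplacian h \<phi> > (- C - 1) * h \<phi>" if "\<phi> \<in> alcove" for \<phi> :: "(real, 'm) vec"
  proof -
    have "q \<phi> \<ge> 0" unfolding q_def by (intro sum_nonneg) simp
    then have "- C - 1 < q \<phi> - C" by simp
    then show ?thesis
      unfolding lap[OF that] using h_pos[OF that] by (simp add: mult.commute)
  qed
  ultimately show ?thesis by blast
qed

end
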